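(* Let $\mathcal{R}$ be a convex region in $\mathbb{R}_+^K$. Then the efficiency for proportional fairness, $\eta_{PF}=C_{PF}(\mathcal{R})/C_{sum}(\mathcal{R})$, is lower bounded by $1/K$.
   Context: $\mathbb{R}_+$ denotes the nonnegative reals. The sum capacity is $C_{sum}(\mathcal{R})=\max_{\mathbf{r}\in\mathcal{R}}\sum_{i=1}^K r_i$. The proportional fair allocation $\mathbf{r}^{PF}=(r_1^{PF},\dots,r_K^{PF})$ is the point of $\mathcal{R}$ maximizing $\sum_{i=1}^K\log r_i$, and the proportional fair capacity is $C_{PF}(\mathcal{R})=\sum_{i=1}^K r_i^{PF}$. The efficiency of an allocation is the ratio of its sum rate (the sum of its components) to the sum capacity. *)

theory Defs
  imports "HOL-Analysis.Analysis"
begin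

definition sum_rate :: "real ^ 'k \<Rightarrow> real" where
  "sum_rate r = (\<Sum>i\<in>UNIV. r $ i)"

text \<open>
  The supremum is the maximum whenever the maximum is attained
  (lemma \<open>sum_capacity_eq_max\<close>).
\<close>

definition sum_capacity :: "(real ^ 'k) set \<Rightarrow> real" where
  "sum_capacity R = (SUP r\<in>R. sum_rate r)"

text \<open>
  The library has \<open>ln 0 = 0\<close>, which would reward a user who gets rate zero.  The
  logarithm of a nonnegative rate is therefore taken in the extended reals, with value
  \<open>-\<infinity>\<close> at zero.
\<close>

definition log_rate :: "real \<Rightarrow> ereal" where
  "log_rate x = (if 0 < x then ereal (ln x) else -\<infinity>)"

definition log_utility :: "real ^ 'k \<Rightarrow> ereal" where
  "log_utility r = (\<Sum>i\<in>UNIV. log_rate (r $ i))"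

definition maximizes_log_utility :: "(real ^ 'k) set \<Rightarrow> real ^ 'k \<Rightarrow> bool" where
  "maximizes_log_utility R r \<longleftrightarrow> r \<in> R \<and> (\<forall>s\<in>R. log_utility s \<le> log_utility r)"

text \<open>
  Meaningful only if there is exactly one maximizer; see \<open>ex1_maximizes_log_utility\<close>.
\<close>

definition pf_allocation :: "(real ^ 'k) set \<Rightarrow> real ^ 'k" where
  "pf_allocation R = (THE r. maximizes_log_utility R r)"

definition pf_capacity :: "(real ^ 'k) set \<Rightarrow> real" where
  "pf_capacity R = sum_rate (pf_allocation R)"

lemma sum_capacity_eq_max:
  assumes "r \<in> R" and "\<And>s. s \<in> R \<Longrightarrow> sum_rate s \<le> sum_rate r"
  shows "sum_capacity R = sum_rate r"
  unfolding sum_capacity_def by (rule cSup_eq_maximum) (use assms in auto)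

lemma log_utility_pos:
  assumes "\<And>i. 0 < r $ i"
  shows "log_utility r = ereal (\<Sum>i\<in>UNIV. ln (r $ i))"
  using assms by (simp add: log_utility_def log_rate_def)

lemma log_utility_not_pos:
  assumes "\<not> 0 < r $ i"
  shows "log_utility r = -\<infinity>"
proof -
  have "(\<Sum>j\<in>UNIV - {i}. log_rate (r $ j)) \<noteq> \<infinity>"
    by (simp add: sum_Pinfty log_rate_def)
  moreover have "log_utility r = log_rate (r $ i) + (\<Sum>j\<in>UNIV - {i}. log_rate (r $ j))"
    unfolding log_utility_def by (simp add: sum.remove)
  ultimately show ?thesis
    using assms by (simp add: log_rate_def)
qed

lemma maximizes_log_utility_pos:
  assumes "maximizes_log_utility R r" and "x \<in> R" and "\<And>i. 0 < x $ i"
  shows "0 < r $ i"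
  using assms log_utility_pos[of x] log_utility_not_pos[of r i]
  by (force simp: maximizes_log_utility_def)

lemma ln_midpoint_less:
  fixes a b :: real
  assumes "0 < a" "0 < b" "a \<noteq> b"
  shows "(ln a + ln b) / 2 < ln ((a + b) / 2)"
proof -
  have "0 < (a - b)\<^sup>2" using assms by simp
  hence "a * b < ((a + b) / 2)\<^sup>2" by (simp add: power2_eq_square field_simps)
  hence "ln (a * b) < ln (((a + b) / 2)\<^sup>2)" using assms by simp
  thus ?thesis using assms by (simp add: ln_mult ln_realpow)
qed

lemma maximizes_log_utility_unique:
  fixes R :: "(real ^ 'k) set"
  assumes "convex R" and x: "x \<in> R" "\<And>i. 0 < x $ i"
    and r: "maximizes_log_utility R r" and s: "maximizes_log_utility R s"
  shows "r = s"
proof (rule ccontr)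
  assume "r \<noteq> s"
  then obtain j where j: "r $ j \<noteq> s $ j" by (auto simp: vec_eq_iff)
  have rp: "0 < r $ i" and sp: "0 < s $ i" for i
    using maximizes_log_utility_pos[OF r x] maximizes_log_utility_pos[OF s x] by auto
  define m where "m = (1/2) *\<^sub>R r + (1/2) *\<^sub>R s"
  have mi: "m $ i = (r $ i + s $ i) / 2" for i by (simp add: m_def field_simps)
  have mR: "m \<in> R"
    unfolding m_def using assms(1) r s
    by (intro convexD) (auto simp: maximizes_log_utility_def)
  have mp: "0 < m $ i" for i using rp[of i] sp[of i] by (simp add: mi)
  have "(\<Sum>i\<in>UNIV. (ln (r $ i) + ln (s $ i)) / 2) < (\<Sum>i\<in>UNIV. ln (m $ i))"
  proof (rule sum_strict_mono_ex1)
    show "\<forall>i\<in>UNIV. (ln (r $ i) + ln (s $ i)) / 2 \<le> ln (m $ i)"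
    proof
      fix i
      show "(ln (r $ i) + ln (s $ i)) / 2 \<le> ln (m $ i)"
        using ln_midpoint_less[OF rp sp, of i i] by (cases "r $ i = s $ i") (auto simp: mi)
    qed
    show "\<exists>i\<in>UNIV. (ln (r $ i) + ln (s $ i)) / 2 < ln (m $ i)"
      using ln_midpoint_less[OF rp sp j] by (auto simp: mi)
  qed simp
  moreover have "log_utility m \<le> log_utility r" "log_utility m \<le> log_utility s"
    using r s mR by (auto simp: maximizes_log_utility_def)
  ultimately show False
    using log_utility_pos[of r, OF rp] log_utility_pos[of s, OF sp] log_utility_pos[of m, OF mp]
    by (simp add: sum_divide_distrib[symmetric] sum.distrib)
qed

lemma ex1_maximizes_log_utility:
  fixes R :: "(real ^ 'k) set"
  assumes "convex R" "compact R" "\<And>r i. r \<in> R \<Longrightarrow> 0 \<le> r $ i"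
    and x: "x \<in> R" "\<And>i. 0 < x $ i"
  shows "\<exists>!r. maximizes_log_utility R r"
proof -
  have "continuous_on R (\<lambda>r. \<Prod>i\<in>UNIV. r $ i)"
    by (intro continuous_intros)
  then obtain r where r: "r \<in> R"
    and max: "\<And>s. s \<in> R \<Longrightarrow> (\<Prod>i\<in>UNIV. s $ i) \<le> (\<Prod>i\<in>UNIV. r $ i)"
    using continuous_attains_sup[of R "\<lambda>r. \<Prod>i\<in>UNIV. r $ i"] assms(2) x(1) by blast
  have "0 < (\<Prod>i\<in>UNIV. x $ i)" using x(2) by (intro prod_pos) auto
  also note max[OF x(1)]
  finally have "(\<Prod>i\<in>UNIV. r $ i) \<noteq> 0" by (rule less_imp_neq[symmetric])
  hence "r $ i \<noteq> 0" for i by simp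
  hence rp: "0 < r $ i" for i using assms(3)[OF r, of i] by (simp add: order_less_le)
  have "log_utility s \<le> log_utility r" if s: "s \<in> R" for s
  proof (cases "\<forall>i. 0 < s $ i")
    case True
    have "ln (\<Prod>i\<in>UNIV. s $ i) \<le> ln (\<Prod>i\<in>UNIV. r $ i)"
      using max[OF s] True rp by (simp add: prod_pos)
    hence "(\<Sum>i\<in>UNIV. ln (s $ i)) \<le> (\<Sum>i\<in>UNIV. ln (r $ i))"
      using True rp by (simp add: ln_prod less_imp_neq[symmetric])
    thus ?thesis using True rp by (simp add: log_utility_pos)
  qed (auto simp: log_utility_not_pos)
  hence "maximizes_log_utility R r" using r by (auto simp: maximizes_log_utility_def)
  thus ?thesis using maximizes_log_utility_unique[OF assms(1) x] by blast
qed

end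

theory Submission
  imports Defs
begin

text \<open>
  If the proportionally fair point \<open>r\<close> has positive rates, the first-order optimality condition
  along the segment from \<open>r\<close> to \<open>s \<in> R\<close> reads \<open>(\<Sum>i. s\<^sub>i / r\<^sub>i) \<le> K\<close>.  Since \<open>r\<^sub>i\<close> is at most the sum
  rate of \<open>r\<close>, this gives \<open>(\<Sum>i. s\<^sub>i) \<le> K (\<Sum>i. r\<^sub>i)\<close>.  Otherwise every point of \<open>R\<close> has utility
  \<open>-\<infinity>\<close>, so uniqueness forces \<open>R = {r}\<close> and the efficiency is 1.
\<close>

lemma maximizes_log_utility_sum_ratio_le:
  fixes R :: "(real ^ 'k) set"
  assumes "convex R" and nonneg: "\<And>i. 0 \<le> s $ i"
    and r: "maximizes_log_utility R r" and rp: "\<And>i. 0 < r $ i" and s: "s \<in> R"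
  shows "(\<Sum>i\<in>UNIV. s $ i / r $ i) \<le> real CARD('k)"
proof (rule ccontr)
  \<comment> \<open>\<open>f\<close> is the log utility along the segment from \<open>r\<close> to
    \<open>s\<close>. A ratio sum above \<open>CARD('k)\<close> makes its slope at 0 positive, so a
    small move toward \<open>s\<close> would beat \<open>r\<close>.\<close>
  define f where "f t = (\<Sum>i\<in>UNIV. ln (r $ i + t * (s $ i - r $ i)))" for t
  assume "\<not> ?thesis"
  moreover have "(\<Sum>i\<in>UNIV. (s $ i - r $ i) / r $ i) = (\<Sum>i\<in>UNIV. s $ i / r $ i) - real CARD('k)"
    using rp by (simp add: diff_divide_distrib sum_subtractf less_imp_neq[symmetric])
  ultimately have "0 < (\<Sum>i\<in>UNIV. (s $ i - r $ i) / r $ i)" by simp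
  moreover have "(f has_real_derivative (\<Sum>i\<in>UNIV. (s $ i - r $ i) / r $ i)) (at 0)"
    unfolding f_def using rp by (auto intro!: derivative_eq_intros)
  ultimately obtain d where d: "0 < d" "\<And>h. 0 < h \<Longrightarrow> h < d \<Longrightarrow> f 0 < f h"
    using DERIV_pos_inc_right[of f _ 0] by auto
  \<comment> \<open>\<open>t < d\<close> gives the increase of \<open>f\<close>;
    \<open>t < 1\<close> keeps a share of \<open>r\<close>, so the mixture is positive even where
    \<open>s\<close> vanishes.\<close>
  define t where "t = min (d / 2) (1 / 2)"
  have t: "0 < t" "t < d" "t < 1" using d(1) by (auto simp: t_def)
  define m where "m = (1 - t) *\<^sub>R r + t *\<^sub>R s"
  have mi: "m $ i = r $ i + t * (s $ i - r $ i)" for i by (simp add: m_def algebra_simps)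
  have mp: "0 < m $ i" for i
    using rp[of i] nonneg[of i] t by (simp add: m_def add_pos_nonneg)
  have "m \<in> R"
    unfolding m_def using assms(1) r s t by (intro convexD) (auto simp: maximizes_log_utility_def)
  hence "log_utility m \<le> log_utility r" using r by (simp add: maximizes_log_utility_def)
  hence "f t \<le> f 0" by (simp add: log_utility_pos rp mp f_def mi[symmetric])
  thus False using d(2)[of t] t by simp
qed

lemma sum_rate_le_maximizes_log_utility:
  fixes R :: "(real ^ 'k) set"
  assumes "convex R" and nonneg: "\<And>i. 0 \<le> s $ i"
    and r: "maximizes_log_utility R r" and rp: "\<And>i. 0 < r $ i" and s: "s \<in> R"
  shows "sum_rate s \<le> real CARD('k) * sum_rate r"
proof -
  have r_le: "r $ i \<le> sum_rate r" for i
    unfolding sum_rate_def using rp by (intro member_le_sum) (auto intro: less_imp_le)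
  \<comment> \<open>Replacing \<open>r $ i\<close> by \<open>sum_rate r\<close> in
    \<open>s $ i / r $ i * r $ i\<close> yields a factor common to all users.\<close>
  have "s $ i \<le> s $ i / r $ i * sum_rate r" for i
    using mult_left_mono[OF r_le[of i], of "s $ i / r $ i"] nonneg[of i] rp[of i] by simp
  hence "sum_rate s \<le> (\<Sum>i\<in>UNIV. s $ i / r $ i) * sum_rate r"
    by (simp add: sum_rate_def[of s] sum_distrib_right sum_mono)
  also have "\<dots> \<le> real CARD('k) * sum_rate r"
    using maximizes_log_utility_sum_ratio_le[OF assms] rp
    by (intro mult_right_mono) (auto simp: sum_rate_def intro: sum_nonneg less_imp_le)
  finally show ?thesis .
qed

theorem theorem4:
  fixes R :: "(real ^ 'k) set"
  assumes "convex R"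
    and "\<And>r i. r \<in> R \<Longrightarrow> 0 \<le> r $ i"
    and "\<exists>!r. maximizes_log_utility R r"
    and "sum_capacity R \<noteq> 0"
  shows "pf_capacity R / sum_capacity R \<ge> 1 / real CARD('k)"
proof -
  obtain r where r: "maximizes_log_utility R r" using assms(3) by blast
  have pf: "pf_capacity R = sum_rate r"
    unfolding pf_capacity_def pf_allocation_def using the1_equality[OF assms(3) r] by simp
  have rR: "r \<in> R" using r by (simp add: maximizes_log_utility_def)
  show ?thesis
  proof (cases "\<forall>i. 0 < r $ i")
    case True
    have le: "sum_rate s \<le> real CARD('k) * sum_rate r" if "s \<in> R" for s
      using sum_rate_le_maximizes_log_utility[OF assms(1) assms(2)[OF that] r _ that] True by blast
    have "sum_capacity R \<le> real CARD('k) * sum_rate r"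
      unfolding sum_capacity_def using rR le by (intro cSUP_least) auto
    \<comment> \<open>\<open>le\<close> also bounds the sum rates above, so the supremum is a true
      upper bound; the denominator is thus positive.\<close>
    moreover have "sum_rate r \<le> sum_capacity R"
      unfolding sum_capacity_def using rR le by (intro cSUP_upper bdd_aboveI2) auto
    moreover have "0 < sum_rate r" unfolding sum_rate_def using True by (intro sum_pos) auto
    ultimately show ?thesis by (simp add: pf field_simps)
  next
    case False
    hence "log_utility r = -\<infinity>" by (auto simp: log_utility_not_pos)
    hence "maximizes_log_utility R s" if "s \<in> R" for s
      using r that by (auto simp: maximizes_log_utility_def)
    hence "R = {r}" using assms(3) r rR by blast
    hence "sum_capacity R = sum_rate r" by (simp add: sum_capacity_def)
    \<comment> \<open>The quotient is 1 because a nonzero capacity excludes \<open>R = {0}\<close>,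
      where \<open>0 / 0 = 0\<close> would break the bound.\<close>
    thus ?thesis using assms(4) by (simp add: pf Suc_leI)
  qed
qed

end
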